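(* The space $$\mathcal F'=\bigcup_{m=1}^\infty\mathcal F_{2-m}=\left\{b=(b_n)_{n\in\mathbb N_0}:\ \exists\, m\ge1,\ \|b\|_{2-m}^2=\sum_{n=0}^\infty\frac{|b_n|^2}{(n!)^{m-2}}<\infty\right\}$$ is a topological algebra with the convolution product $*$: the convolution product is jointly continuous with respect to the two variables, and satisfies $$\|a*b\|_{2-q}\le A(q-p)\,\|a\|_{2-q}\,\|b\|_{2-p}$$ for every $a\in\mathcal F_{2-q}$ and $b\in\mathcal F_{2-p}$, where $p,q\in\mathbb N$ are such that $q\ge p+1$.
   Context: $\mathbb N=\{1,2,\dots\}$ and $\mathbb N_0=\{0,1,2,\dots\}$. For every integer $m\ge1$, $$\mathcal F_{2-m}=\left\{b=(b_n)_{n\in\mathbb N_0}\subset\mathbb C:\ \|b\|_{2-m}^2:=\sum_{n=0}^\infty|b_n|^2(n!)^{2-m}<\infty\right\}.$$ The convolution (Cauchy) product of complex sequences $a=(a_n)_{n\in\mathbb N_0}$ and $b=(b_n)_{n\in\mathbb N_0}$ is $a*b=\left(\sum_{k=0}^na_kb_{n-k}\right)_{n\in\mathbb N_0}$. For integers $r\ge1$, $$A(r)=\left(\sum_{n=0}^\infty\left(\frac1{n!}\right)^{r}\right)^{1/2}<\infty .$$ Topology on $\mathcal F'$: for $m\ge1$ let $\mathcal F_m$ be the Hilbert space of entire functions $f(z)=\sum_{n=0}^\infty f_nz^n$ with $\|f\|_m^2=\sum_{n=0}^\infty|f_n|^2(n!)^m<\infty$, and let $\mathcal F=\bigcap_{m=1}^\infty\mathcal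 F_m$ be the Fréchet space topologized by the norms $\|\cdot\|_m$, $m\ge1$. The space $\mathcal F_{2-m}$ is the dual of $\mathcal F_m$ with respect to the Fock space $\mathcal F_1$, i.e. through the pairing $(f,b)\mapsto\sum_{n=0}^\infty f_n\overline{b_n}\,n!$. In this way $\mathcal F'=\bigcup_{m=1}^\infty\mathcal F_{2-m}$ is identified with the dual of $\mathcal F$, and it is endowed with the strong dual topology. *)

theory Defs
  imports "HOL-Analysis.Analysis" "HOL-Algebra.Module"
begin

(* The norm with weight (n!)^k. The exponent k is an integer since the dual spaces use k = 2 - m;
   the norm is only meaningful on weighted_l2 k. *)
definition weighted_l2 :: "int \<Rightarrow> (nat \<Rightarrow> complex) set" where
  "weighted_l2 k = {b. summable (\<lambda>n. (cmod (b n))\<^sup>2 * (fact n :: real) powi k)}"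

definition weighted_norm :: "int \<Rightarrow> (nat \<Rightarrow> complex) \<Rightarrow> real" where
  "weighted_norm k b = sqrt (\<Sum>n. (cmod (b n))\<^sup>2 * (fact n :: real) powi k)"

definition taylor_coeff :: "(complex \<Rightarrow> complex) \<Rightarrow> nat \<Rightarrow> complex" where
  "taylor_coeff f n = (deriv ^^ n) f 0 / fact n"

definition fock_space :: "nat \<Rightarrow> (complex \<Rightarrow> complex) set" where
  "fock_space m = {f. f holomorphic_on UNIV \<and> taylor_coeff f \<in> weighted_l2 (int m)}"

definition fock_norm :: "nat \<Rightarrow> (complex \<Rightarrow> complex) \<Rightarrow> real" where
  "fock_norm m f = weighted_norm (int m) (taylor_coeff f)"

definition F_frechet :: "(complex \<Rightarrow> complex) set" where
  "F_frechet = (\<Inter>m\<in>{1..}. fock_space m)"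

(* Boundedness in the locally convex space whose topology is given by the norms fock_norm m. *)
definition F_bounded :: "(complex \<Rightarrow> complex) set \<Rightarrow> bool" where
  "F_bounded B \<longleftrightarrow> B \<subseteq> F_frechet \<and> (\<forall>m\<ge>1. \<exists>C. \<forall>f\<in>B. fock_norm m f \<le> C)"

definition F_dual :: "(nat \<Rightarrow> complex) set" where
  "F_dual = (\<Union>m\<in>{1..}. weighted_l2 (2 - int m))"

(* Antilinear in b; the series converges absolutely for f in F_frechet and b in F_dual. *)
definition fock_pairing :: "(complex \<Rightarrow> complex) \<Rightarrow> (nat \<Rightarrow> complex) \<Rightarrow> complex" where
  "fock_pairing f b = (\<Sum>n. taylor_coeff f n * cnj (b n) * fact n)"

(* Neighbourhoods of b for uniform convergence on bounded subsets of F_frechet. *)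
definition strong_nbhd ::
    "(nat \<Rightarrow> complex) \<Rightarrow> (complex \<Rightarrow> complex) set \<Rightarrow> real \<Rightarrow> (nat \<Rightarrow> complex) set" where
  "strong_nbhd b B \<epsilon> = {c \<in> F_dual. \<forall>f\<in>B. cmod (fock_pairing f (\<lambda>n. c n - b n)) \<le> \<epsilon>}"

definition strong_dual_open :: "(nat \<Rightarrow> complex) set \<Rightarrow> bool" where
  "strong_dual_open U \<longleftrightarrow> U \<subseteq> F_dual \<and>
     (\<forall>b\<in>U. \<exists>B \<epsilon>. F_bounded B \<and> 0 < \<epsilon> \<and> strong_nbhd b B \<epsilon> \<subseteq> U)"

definition strong_dual_topology :: "(nat \<Rightarrow> complex) topology" where
  "strong_dual_topology = topology strong_dual_open"

lemma F_bounded_Un: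
  assumes "F_bounded B" "F_bounded B'"
  shows "F_bounded (B \<union> B')"
  unfolding F_bounded_def
proof (intro conjI allI impI)
  show "B \<union> B' \<subseteq> F_frechet" using assms by (auto simp: F_bounded_def)
  fix m :: nat assume "1 \<le> m"
  then obtain C C' where "\<forall>f\<in>B. fock_norm m f \<le> C" "\<forall>f\<in>B'. fock_norm m f \<le> C'"
    using assms unfolding F_bounded_def by meson
  then have "\<forall>f\<in>B \<union> B'. fock_norm m f \<le> max C C'" by (auto simp: le_max_iff_disj)
  then show "\<exists>C. \<forall>f\<in>B \<union> B'. fock_norm m f \<le> C" by blast
qed

lemma istopology_strong_dual_open: "istopology strong_dual_open"
  unfolding istopology_def
proof (intro conjI allI impI)
  fix S T assume S: "strong_dual_open S" and T: "strong_dual_open T"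
  show "strong_dual_open (S \<inter> T)"
    unfolding strong_dual_open_def
  proof (intro conjI ballI)
    show "S \<inter> T \<subseteq> F_dual" using S by (auto simp: strong_dual_open_def)
    fix b assume "b \<in> S \<inter> T"
    then obtain B \<epsilon> B' \<epsilon>' where "F_bounded B" "0 < \<epsilon>" "strong_nbhd b B \<epsilon> \<subseteq> S"
      "F_bounded B'" "0 < \<epsilon>'" "strong_nbhd b B' \<epsilon>' \<subseteq> T"
      using S T unfolding strong_dual_open_def by blast
    moreover have "strong_nbhd b (B \<union> B') (min \<epsilon> \<epsilon>') \<subseteq> strong_nbhd b B \<epsilon> \<inter> strong_nbhd b B' \<epsilon>'"
      by (auto simp: strong_nbhd_def)
    ultimately show "\<exists>B \<epsilon>. F_bounded B \<and> 0 < \<epsilon> \<and> strong_nbhd b B \<epsilon> \<subseteq> S \<inter> T"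
      by (intro exI[of _ "B \<union> B'"] exI[of _ "min \<epsilon> \<epsilon>'"]) (auto intro: F_bounded_Un)
  qed
next
  fix K assume "\<forall>S\<in>K. strong_dual_open S"
  then show "strong_dual_open (\<Union> K)"
    unfolding strong_dual_open_def by (meson Sup_le_iff UnionE Union_upper subset_trans)
qed

lemma openin_strong_dual_topology: "openin strong_dual_topology = strong_dual_open"
  by (simp add: strong_dual_topology_def topology_inverse' istopology_strong_dual_open)

lemma topspace_strong_dual_topology: "topspace strong_dual_topology = F_dual"
proof -
  have "F_bounded {}" by (simp add: F_bounded_def)
  then have "strong_dual_open F_dual"
    unfolding strong_dual_open_def strong_nbhd_def
    by (auto intro!: exI[of _ "{}"] exI[of _ "1::real"])
  then show ?thesis
    unfolding topspace_def openin_strong_dual_topology by (auto simp: strong_dual_open_def)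
qed

definition convolution :: "(nat \<Rightarrow> complex) \<Rightarrow> (nat \<Rightarrow> complex) \<Rightarrow> nat \<Rightarrow> complex"
    (infixl \<open>\<star>\<close> 70) where
  "a \<star> b = (\<lambda>n. \<Sum>k\<le>n. a k * b (n - k))"

definition A_const :: "nat \<Rightarrow> real" where
  "A_const r = sqrt (\<Sum>n. (1 / fact n) ^ r)"

lemma summable_A_const:
  assumes "1 \<le> r"
  shows "summable (\<lambda>n. (1 / fact n :: real) ^ r)"
proof (rule summable_comparison_test')
  show "summable (\<lambda>n. 1 / fact n :: real)"
    using summable_exp[of "1::real"] by (simp add: divide_inverse)
  fix n :: nat
  have "(1 / fact n :: real) ^ r \<le> (1 / fact n) ^ 1"
    using assms by (intro power_decreasing) (auto simp: field_simps fact_ge_1)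
  then show "norm ((1 / fact n :: real) ^ r) \<le> 1 / fact n" by simp
qed

definition complex_ring :: "complex ring" where
  "complex_ring = \<lparr>carrier = UNIV, mult = (*), one = 1, zero = 0, add = (+)\<rparr>"

(* A Hausdorff topological vector space over the complex numbers with a bilinear, associative and
   unital multiplication that is jointly continuous. Bilinearity consists of the distributive
   laws contained in Ring.ring and of the two compatibility laws with scalars. *)
definition topological_algebra :: "'a topology \<Rightarrow> (complex, 'a) module \<Rightarrow> bool" where
  "topological_algebra T M \<longleftrightarrow>
     Module.module complex_ring M \<and> Ring.ring M \<and>
     (\<forall>c. \<forall>x\<in>carrier M. \<forall>y\<in>carrier M.
        (c \<odot>\<^bsub>M\<^esub> x) \<otimes>\<^bsub>M\<^esub> y = c \<odot>\<^bsub>M\<^esub> (x \<otimes>\<^bsub>M\<^esub> y) \<and>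
        x \<otimes>\<^bsub>M\<^esub> (c \<odot>\<^bsub>M\<^esub> y) = c \<odot>\<^bsub>M\<^esub> (x \<otimes>\<^bsub>M\<^esub> y)) \<and>
     topspace T = carrier M \<and> Hausdorff_space T \<and>
     continuous_map (prod_topology T T) T (\<lambda>(x, y). x \<oplus>\<^bsub>M\<^esub> y) \<and>
     continuous_map (prod_topology euclidean T) T (\<lambda>(c, x). c \<odot>\<^bsub>M\<^esub> x) \<and>
     continuous_map (prod_topology T T) T (\<lambda>(x, y). x \<otimes>\<^bsub>M\<^esub> y)"

definition F_dual_algebra :: "(complex, nat \<Rightarrow> complex) module" where
  "F_dual_algebra =
     \<lparr>carrier = F_dual, mult = (\<star>), one = (\<lambda>n. if n = 0 then 1 else 0),
      zero = (\<lambda>n. 0), add = (\<lambda>a b n. a n + b n), smult = (\<lambda>c a n. c * a n)\<rparr>"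

end

theory Submission
  imports Defs
begin

text \<open>
  A set of functions in \<open>F_frechet\<close> is bounded iff the Taylor coefficients of its members are
  dominated by one sequence that decreases faster than every power of \<open>1 / n!\<close>. Hence the strong
  topology is generated by the seminorms \<open>b \<mapsto> (\<Sum>n. v n * |b n|)\<close> with such weights \<open>v\<close>. Every weight
  has an antitone majorant \<open>w\<close>, and \<open>w (j + k) \<le> sqrt (w j) * sqrt (w k)\<close> makes the seminorm of \<open>a \<star> b\<close>
  at most the product of the seminorms of \<open>a\<close> and \<open>b\<close> for the weight \<open>sqrt \<circ> w\<close>, which gives joint
  continuity. The norm estimate is Young's inequality for \<open>l\<^sup>2\<close> and \<open>l\<^sup>1\<close>, because
  \<open>n! \<ge> k! (n - k)!\<close> makes the weight \<open>(n!)\<close> to the power \<open>2 - q \<le> 0\<close> submultiplicative, followed by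
  Cauchy--Schwarz for the \<open>l\<^sup>1\<close> factor.\<close>

section \<open>Comparison of series and factorial inequalities\<close>

lemma summable_le_nonneg:
  fixes f g :: "nat \<Rightarrow> real"
  assumes "summable g" "\<And>n. 0 \<le> f n" "\<And>n. f n \<le> g n"
  shows "summable f"
  using assms by (intro summable_comparison_test'[of g 0 f]) auto

lemma one_div_fact_sums: "(\<lambda>n. 1 / fact n :: real) sums exp 1"
  using exp_converges[of "1::real"] by (simp add: divide_inverse)

text \<open>The quotient of the two sides is a binomial coefficient, a positive integer.\<close>

lemma fact_mult_fact_diff_le:
  assumes "k \<le> n"
  shows "(fact k * fact (n - k) :: real) \<le> fact n"
proof -
  have "fact k * fact (n - k) dvd (fact n :: nat)"
    using fact_fact_dvd_fact[of k "n - k"] assms by simp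
  then have "fact k * fact (n - k) \<le> (fact n :: nat)"
    by (rule dvd_imp_le) simp
  then show ?thesis
    by (metis of_nat_fact of_nat_le_iff of_nat_mult)
qed

text \<open>Lets the number \<open>n + 1\<close> of terms in a convolution sum be absorbed into one
  more power of \<open>fact n\<close>.\<close>

lemma Suc_le_two_mult_fact: "real (Suc n) \<le> 2 * fact n"
proof (cases n)
  case (Suc k)
  have "n \<le> fact n" by (rule fact_ge_self)
  then have "real n \<le> real (fact n)" by (simp only: of_nat_le_iff)
  moreover have "(1 :: real) \<le> fact n" by (rule fact_ge_1)
  ultimately show ?thesis unfolding of_nat_Suc of_nat_fact by linarith
qed simp

section \<open>Growth of sequences in the dual\<close>

text \<open>Weighted square summability and a pointwise bound differ only by fixed powers of
  \<open>fact n\<close>, and the union over \<open>m\<close> absorbs this loss. Closure of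
  \<open>F_dual\<close> under the operations thus becomes a matter of pointwise estimates.\<close>

lemma F_dual_iff_growth: "b \<in> F_dual \<longleftrightarrow> (\<exists>m C. \<forall>n. cmod (b n) \<le> C * fact n ^ m)"
proof
  assume "b \<in> F_dual"
  then obtain m :: nat where m: "summable (\<lambda>n. (cmod (b n))\<^sup>2 * (fact n :: real) powi (2 - int m))"
    by (auto simp: F_dual_def weighted_l2_def)
  let ?S = "\<Sum>n. (cmod (b n))\<^sup>2 * (fact n :: real) powi (2 - int m)"
  have "cmod (b n) \<le> sqrt ?S * fact n ^ m" for n
  proof -
    \<comment> \<open>The exponent is lowered to an even number so that the square root of the
      weight is an integral power of \<open>fact n\<close>.\<close>
    have "(fact n :: real) powi (- int (2 * m)) \<le> fact n powi (2 - int m)"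
      by (rule power_int_increasing) (auto simp: fact_ge_1)
    then have "(cmod (b n))\<^sup>2 * (fact n :: real) powi (- int (2 * m)) \<le> (cmod (b n))\<^sup>2 * fact n powi (2 - int m)"
      by (rule mult_left_mono) simp
    also have "\<dots> \<le> ?S"
      using sum_le_suminf[OF m, of "{n}"] by simp
    also have "(fact n :: real) powi (- int (2 * m)) = 1 / (fact n ^ m)\<^sup>2"
      by (simp only: power_int_minus power_int_of_nat power_mult mult.commute[of 2 m] inverse_eq_divide)
    finally have "(cmod (b n) / fact n ^ m)\<^sup>2 \<le> ?S"
      by (simp add: power_divide)
    then have "cmod (b n) / fact n ^ m \<le> sqrt ?S"
      by (rule real_le_rsqrt)
    then show ?thesis by (simp add: field_simps)
  qed
  then show "\<exists>m C. \<forall>n. cmod (b n) \<le> C * fact n ^ m" by blast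
next
  assume "\<exists>m C. \<forall>n. cmod (b n) \<le> C * fact n ^ m"
  then obtain m C where C: "\<And>n. cmod (b n) \<le> C * fact n ^ m" by blast
  \<comment> \<open>The index \<open>2 * m + 3\<close> gives the weight exponent
    \<open>- (2 * m + 1)\<close>: the part \<open>2 * m\<close> cancels the squared growth, and the
    remaining \<open>1 / fact n\<close> is summable.\<close>
  have "(cmod (b n))\<^sup>2 * (fact n :: real) powi (2 - int (2 * m + 3)) \<le> C\<^sup>2 * (1 / fact n)" for n
  proof -
    have "2 - int (2 * m + 3) = - int (2 * m + 1)" by simp
    then have e: "(fact n :: real) powi (2 - int (2 * m + 3)) = 1 / (fact n ^ m)\<^sup>2 / fact n"
      by (simp only: power_int_minus power_int_of_nat power_add power_mult mult.commute[of 2 m])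
        (simp add: divide_inverse)
    have "(cmod (b n))\<^sup>2 * (fact n :: real) powi (2 - int (2 * m + 3))
        = (cmod (b n) / fact n ^ m)\<^sup>2 * (1 / fact n)"
      unfolding e power_divide by simp
    moreover have "(cmod (b n) / fact n ^ m)\<^sup>2 \<le> C\<^sup>2"
      using C[of n] by (intro power_mono) (simp_all add: pos_divide_le_eq)
    then have "(cmod (b n) / fact n ^ m)\<^sup>2 * (1 / fact n) \<le> C\<^sup>2 * (1 / fact n)"
      by (rule mult_right_mono) simp
    ultimately show ?thesis by (simp only:)
  qed
  then have "b \<in> weighted_l2 (2 - int (2 * m + 3))"
    unfolding weighted_l2_def mem_Collect_eq
    by (rule summable_le_nonneg[OF summable_mult[OF sums_summable[OF one_div_fact_sums]], rotated]) simp
  then show "b \<in> F_dual" unfolding F_dual_def by (rule UN_I[rotated]) simp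
qed

lemma F_dual_growthE:
  assumes "b \<in> F_dual"
  obtains m C where "C \<ge> 0" "\<And>n. cmod (b n) \<le> C * fact n ^ m"
proof -
  obtain m C where C: "\<And>n. cmod (b n) \<le> C * fact n ^ m"
    using assms by (auto simp: F_dual_iff_growth)
  moreover have "C \<ge> 0" using order_trans[OF norm_ge_zero C, of 0] by simp
  ultimately show thesis using that by blast
qed

lemma F_dual_growth_common:
  assumes "a \<in> F_dual" "b \<in> F_dual"
  shows "\<exists>m C D. C \<ge> 0 \<and> D \<ge> 0 \<and>
    (\<forall>n. cmod (a n) \<le> C * fact n ^ m) \<and> (\<forall>n. cmod (b n) \<le> D * fact n ^ m)"
proof -
  obtain m C where C: "C \<ge> 0" "\<And>n. cmod (a n) \<le> C * fact n ^ m"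
    by (rule F_dual_growthE[OF assms(1)]) blast
  obtain m' D where D: "D \<ge> 0" "\<And>n. cmod (b n) \<le> D * fact n ^ m'"
    by (rule F_dual_growthE[OF assms(2)]) blast
  have le: "C * fact n ^ m \<le> C * fact n ^ max m m'" "D * fact n ^ m' \<le> D * fact n ^ max m m'" for n
    using C(1) D(1) by (auto intro!: mult_left_mono power_increasing simp: fact_ge_1)
  show ?thesis
    using C(1) D(1) order_trans[OF C(2) le(1)] order_trans[OF D(2) le(2)] by blast
qed

lemma F_dual_add: "a \<in> F_dual \<Longrightarrow> b \<in> F_dual \<Longrightarrow> (\<lambda>n. a n + b n) \<in> F_dual"
proof -
  assume "a \<in> F_dual" "b \<in> F_dual"
  then obtain m C D where C: "\<And>n. cmod (a n) \<le> C * fact n ^ m" "\<And>n. cmod (b n) \<le> D * fact n ^ m"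
    using F_dual_growth_common by meson
  have "cmod (a n + b n) \<le> (C + D) * fact n ^ m" for n
    using norm_triangle_ineq[of "a n" "b n"] C[of n] by (simp add: distrib_right)
  then show ?thesis unfolding F_dual_iff_growth by blast
qed

text \<open>Each term of the convolution is at most \<open>C * D * fact n ^ m\<close>, since
  \<open>fact k * fact (n - k) <= fact n\<close>; the number of terms costs one further
  factorial.\<close>

lemma F_dual_conv: "a \<in> F_dual \<Longrightarrow> b \<in> F_dual \<Longrightarrow> a \<star> b \<in> F_dual"
proof -
  assume "a \<in> F_dual" "b \<in> F_dual"
  then obtain m C D where pos: "C \<ge> 0" "D \<ge> 0" and
    C: "\<And>n. cmod (a n) \<le> C * fact n ^ m" "\<And>n. cmod (b n) \<le> D * fact n ^ m"
    using F_dual_growth_common by meson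
  have "cmod ((a \<star> b) n) \<le> 2 * (C * D) * fact n ^ Suc m" for n
  proof -
    have "cmod (a k * b (n - k)) \<le> C * D * fact n ^ m" if "k \<in> {..n}" for k
    proof -
      have "cmod (a k * b (n - k)) \<le> (C * fact k ^ m) * (D * fact (n - k) ^ m)"
        unfolding norm_mult using pos by (intro mult_mono C) auto
      also have "\<dots> = C * D * (fact k * fact (n - k)) ^ m"
        by (simp add: power_mult_distrib)
      also have "\<dots> \<le> C * D * fact n ^ m"
        using pos that by (intro mult_left_mono power_mono fact_mult_fact_diff_le) auto
      finally show ?thesis .
    qed
    then have "cmod ((a \<star> b) n) \<le> real (card {..n}) * (C * D * fact n ^ m)"
      unfolding convolution_def by (intro order_trans[OF norm_sum] sum_bounded_above)
    also have "\<dots> \<le> (2 * fact n) * (C * D * fact n ^ m)"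
      using pos Suc_le_two_mult_fact[of n] by (intro mult_right_mono) auto
    finally show ?thesis by (simp add: mult_ac)
  qed
  then show ?thesis unfolding F_dual_iff_growth by blast
qed

lemma F_dual_delta: "(\<lambda>n. if n = 0 then c else 0) \<in> F_dual"
  unfolding F_dual_iff_growth by (intro exI[of _ "0::nat"] exI[of _ "cmod c"]) auto

lemma F_dual_zero: "(\<lambda>n. 0) \<in> F_dual"
  using F_dual_delta[of 0] by simp

text \<open>Scalars embed as sequences supported at 0, so scaling is a special case of convolution
  and inherits closure, compatibility with products and continuity from it. The case
  \<open>c = 1\<close> is the unit law.\<close>

lemma conv_delta: "(\<lambda>n. if n = 0 then c else 0) \<star> b = (\<lambda>n. c * b n)"
proof
  fix n
  have "((\<lambda>n. if n = 0 then c else 0) \<star> b) n = (\<Sum>k\<le>n. if k = 0 then c * b n else 0)"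
    unfolding convolution_def by (intro sum.cong) auto
  then show "((\<lambda>n. if n = 0 then c else 0) \<star> b) n = c * b n" by simp
qed

lemma F_dual_scale: "b \<in> F_dual \<Longrightarrow> (\<lambda>n. c * b n) \<in> F_dual"
  using F_dual_conv[OF F_dual_delta] by (simp add: conv_delta)

lemma F_dual_diff: "a \<in> F_dual \<Longrightarrow> b \<in> F_dual \<Longrightarrow> (\<lambda>n. a n - b n) \<in> F_dual"
  using F_dual_add[of a "\<lambda>n. - 1 * b n"] F_dual_scale[of b "- 1"] by simp

text \<open>Commutativity and associativity are inherited from the ring of formal power
  series.\<close>

lemma conv_eq_fps_nth: "a \<star> b = fps_nth (Abs_fps a * Abs_fps b)"
  by (simp add: fun_eq_iff convolution_def fps_mult_nth atLeast0AtMost)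

lemma conv_commute: "a \<star> b = b \<star> a"
  by (simp add: conv_eq_fps_nth mult.commute)

lemma conv_assoc: "a \<star> b \<star> c = a \<star> (b \<star> c)"
  by (simp add: conv_eq_fps_nth fps_nth_inverse mult.assoc)

lemma conv_add_left: "(\<lambda>n. a n + b n) \<star> c = (\<lambda>n. (a \<star> c) n + (b \<star> c) n)"
  by (simp add: convolution_def algebra_simps sum.distrib)

section \<open>Rapidly decreasing weights\<close>

text \<open>Zeros are allowed: a weight supported at a single index yields a coordinate seminorm,
  which is what separates points.\<close>

definition decreasing_weights :: "(nat \<Rightarrow> real) set" where
  "decreasing_weights = {v. (\<forall>n. 0 \<le> v n) \<and> (\<forall>m. \<exists>C. \<forall>n. v n * fact n ^ m \<le> C)}"

definition weight_seminorm :: "(nat \<Rightarrow> real) \<Rightarrow> (nat \<Rightarrow> complex) \<Rightarrow> real" where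
  "weight_seminorm v b = (\<Sum>n. v n * cmod (b n))"

lemma decreasing_weights_nonneg: "v \<in> decreasing_weights \<Longrightarrow> 0 \<le> v n"
  by (simp add: decreasing_weights_def)

lemma decreasing_weights_bound:
  assumes "v \<in> decreasing_weights"
  obtains C where "\<And>n. v n * fact n ^ m \<le> C"
proof -
  obtain C where "\<forall>n. v n * fact n ^ m \<le> C"
    using assms unfolding decreasing_weights_def by blast
  then show thesis using that by blast
qed

lemma summable_weight_seminorm:
  assumes v: "v \<in> decreasing_weights" and b: "b \<in> F_dual"
  shows "summable (\<lambda>n. v n * cmod (b n))"
proof -
  obtain m C where C: "C \<ge> 0" "\<And>n. cmod (b n) \<le> C * fact n ^ m"
    by (rule F_dual_growthE[OF b]) blast
  \<comment> \<open>One power more than the growth of \<open>b\<close>, so that a summable factor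
    \<open>1 / fact n\<close> is left over.\<close>
  obtain D where D: "\<And>n. v n * fact n ^ Suc m \<le> D"
    by (rule decreasing_weights_bound[OF v]) blast
  have "v n * cmod (b n) \<le> C * D * (1 / fact n)" for n
  proof -
    have "v n * cmod (b n) \<le> v n * (C * fact n ^ m)"
      by (intro mult_left_mono C decreasing_weights_nonneg[OF v])
    also have "\<dots> = C * (v n * fact n ^ Suc m) * (1 / fact n)" by simp
    also have "\<dots> \<le> C * D * (1 / fact n)"
      by (intro mult_right_mono mult_left_mono D C) simp
    finally show ?thesis .
  qed
  then show ?thesis
    by (rule summable_le_nonneg[OF summable_mult[OF sums_summable[OF one_div_fact_sums]], rotated])
      (simp add: decreasing_weights_nonneg[OF v])
qed

lemma weight_seminorm_nonneg:
  "v \<in> decreasing_weights \<Longrightarrow> b \<in> F_dual \<Longrightarrow> 0 \<le> weight_seminorm v b"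
  unfolding weight_seminorm_def
  by (intro suminf_nonneg summable_weight_seminorm) (auto simp: decreasing_weights_nonneg)

lemma weight_seminorm_add_le:
  assumes v: "v \<in> decreasing_weights" and ab: "a \<in> F_dual" "b \<in> F_dual"
  shows "weight_seminorm v (\<lambda>n. a n + b n) \<le> weight_seminorm v a + weight_seminorm v b"
proof -
  have "weight_seminorm v (\<lambda>n. a n + b n) \<le> (\<Sum>n. v n * cmod (a n) + v n * cmod (b n))"
    unfolding weight_seminorm_def
  proof (intro suminf_le summable_add summable_weight_seminorm F_dual_add v ab)
    fix n
    show "v n * cmod (a n + b n) \<le> v n * cmod (a n) + v n * cmod (b n)"
      using mult_left_mono[OF norm_triangle_ineq decreasing_weights_nonneg[OF v]]
      by (simp add: distrib_left)
  qed
  also have "\<dots> = weight_seminorm v a + weight_seminorm v b"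
    unfolding weight_seminorm_def by (intro suminf_add[symmetric] summable_weight_seminorm v ab)
  finally show ?thesis .
qed

text \<open>The bound on \<open>v\<close> for the exponent \<open>2 * m\<close> becomes, under the
  square root, the bound for the exponent \<open>m\<close>.\<close>

lemma sqrt_decreasing_weights:
  assumes "v \<in> decreasing_weights"
  shows "(\<lambda>n. sqrt (v n)) \<in> decreasing_weights"
  unfolding decreasing_weights_def mem_Collect_eq
proof (intro conjI allI)
  fix m
  obtain C where C: "\<And>n. v n * fact n ^ (2 * m) \<le> C"
    by (rule decreasing_weights_bound[OF assms]) blast
  have "sqrt (v n) * fact n ^ m \<le> sqrt C" for n
  proof -
    have "sqrt (v n) * fact n ^ m = sqrt (v n * fact n ^ (2 * m))"
      by (simp add: real_sqrt_mult power_mult mult.commute[of 2 m] del: power_even_eq)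
    then show ?thesis using C[of n] by simp
  qed
  then show "\<exists>C. \<forall>n. sqrt (v n) * fact n ^ m \<le> C" by blast
qed (simp add: decreasing_weights_nonneg[OF assms])

text \<open>The supremum over the tail from \<open>n\<close> on is antitone by construction. It
  keeps the decay because \<open>fact n <= fact i\<close> for every index \<open>i\<close> of the
  tail.\<close>

lemma decreasing_weights_antimono_majorant:
  assumes v: "v \<in> decreasing_weights"
  obtains u where "u \<in> decreasing_weights" "antimono u" "\<And>n. v n \<le> u n"
proof -
  define u where "u n = (SUP i\<in>{n..}. v i)" for n
  obtain K where K: "\<And>n. v n * fact n ^ 0 \<le> K"
    by (rule decreasing_weights_bound[OF v]) blast
  have bdd: "bdd_above (v ` {n..})" for n
    using K by (auto simp: bdd_above_def)
  have vu: "v i \<le> u n" if "n \<le> i" for i n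
    unfolding u_def by (rule cSUP_upper[OF _ bdd]) (use that in simp)
  have "antimono u"
    unfolding u_def by (intro antimonoI cSUP_subset_mono bdd) auto
  moreover have "u \<in> decreasing_weights"
    unfolding decreasing_weights_def mem_Collect_eq
  proof (intro conjI allI)
    fix m
    obtain C where C: "\<And>n. v n * fact n ^ m \<le> C"
      by (rule decreasing_weights_bound[OF v]) blast
    have "u n * fact n ^ m \<le> C" for n
    proof -
      have "v i \<le> C / fact n ^ m" if "n \<le> i" for i
      proof -
        have "v i * fact n ^ m \<le> v i * fact i ^ m"
          using that by (intro mult_left_mono power_mono fact_mono decreasing_weights_nonneg[OF v]) auto
        also have "\<dots> \<le> C" by (rule C)
        finally show ?thesis by (simp add: pos_le_divide_eq)
      qed
      then have "u n \<le> C / fact n ^ m"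
        unfolding u_def by (intro cSUP_least) auto
      then show ?thesis by (simp add: pos_le_divide_eq)
    qed
    then show "\<exists>C. \<forall>n. u n * fact n ^ m \<le> C" by blast
  qed (use order_trans[OF decreasing_weights_nonneg[OF v] vu[OF order_refl]] in blast)
  ultimately show thesis using that vu by blast
qed

text \<open>Once \<open>v\<close> is antitone, \<open>v (j + k) \<le> sqrt (v j) * sqrt (v k)\<close>, and \<open>sqrt \<circ> v\<close> still decreases
  faster than any power of \<open>1 / n!\<close>.\<close>

lemma weight_seminorm_conv_le:
  assumes v: "v \<in> decreasing_weights"
  obtains u where "u \<in> decreasing_weights"
    "\<And>a b. a \<in> F_dual \<Longrightarrow> b \<in> F_dual \<Longrightarrow>
       weight_seminorm v (a \<star> b) \<le> weight_seminorm u a * weight_seminorm u b"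
proof -
  obtain w where w: "w \<in> decreasing_weights" "antimono w" "\<And>n. v n \<le> w n"
    by (rule decreasing_weights_antimono_majorant[OF v]) blast
  define u where "u n = sqrt (w n)" for n
  have u: "u \<in> decreasing_weights"
    unfolding u_def by (rule sqrt_decreasing_weights[OF w(1)])
  have vu: "v n \<le> u k * u (n - k)" if "k \<le> n" for n k
  proof -
    have "v n = sqrt (v n) * sqrt (v n)"
      using decreasing_weights_nonneg[OF v] by simp
    also have "\<dots> \<le> u k * u (n - k)"
      unfolding u_def using that
      by (intro mult_mono real_sqrt_le_mono order_trans[OF w(3) antimonoD[OF w(2)]])
        (auto simp: decreasing_weights_nonneg[OF v] decreasing_weights_nonneg[OF w(1)])
    finally show ?thesis .
  qed
  have "weight_seminorm v (a \<star> b) \<le> weight_seminorm u a * weight_seminorm u b"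
    if ab: "a \<in> F_dual" "b \<in> F_dual" for a b
  proof -
    have sm: "summable (\<lambda>n. norm (u n * cmod (a n)))" "summable (\<lambda>n. norm (u n * cmod (b n)))"
      using summable_weight_seminorm[OF u ab(1)] summable_weight_seminorm[OF u ab(2)]
      by (simp_all add: abs_mult decreasing_weights_nonneg[OF u])
    have le: "v n * cmod ((a \<star> b) n) \<le> (\<Sum>k\<le>n. (u k * cmod (a k)) * (u (n - k) * cmod (b (n - k))))" for n
    proof -
      have "v n * cmod ((a \<star> b) n) \<le> v n * (\<Sum>k\<le>n. cmod (a k) * cmod (b (n - k)))"
        unfolding convolution_def
        by (intro mult_left_mono sum_norm_le decreasing_weights_nonneg[OF v]) (simp add: norm_mult)
      also have "\<dots> \<le> (\<Sum>k\<le>n. (u k * u (n - k)) * (cmod (a k) * cmod (b (n - k))))"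
        unfolding sum_distrib_left by (intro sum_mono mult_right_mono vu) auto
      finally show ?thesis by (simp add: mult_ac)
    qed
    \<comment> \<open>By absolute convergence the product of the two seminorms is the sum of their
      Cauchy product, so the termwise bound suffices.\<close>
    show ?thesis
      unfolding weight_seminorm_def Cauchy_product[OF sm]
      by (intro suminf_le le summable_Cauchy_product sm summable_weight_seminorm v F_dual_conv ab)
  qed
  then show thesis using that u by blast
qed

section \<open>The seminorms defining the strong topology\<close>

lemma powi_le_weighted_norm:
  assumes "b \<in> weighted_l2 k"
  shows "(cmod (b n))\<^sup>2 * (fact n :: real) powi k \<le> (weighted_norm k b)\<^sup>2"
proof -
  have s: "summable (\<lambda>n. (cmod (b n))\<^sup>2 * (fact n :: real) powi k)"
    using assms by (simp add: weighted_l2_def)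
  have "0 \<le> (\<Sum>n. (cmod (b n))\<^sup>2 * (fact n :: real) powi k)"
    by (intro suminf_nonneg s) simp
  then have "(weighted_norm k b)\<^sup>2 = (\<Sum>n. (cmod (b n))\<^sup>2 * (fact n :: real) powi k)"
    by (simp add: weighted_norm_def)
  then show ?thesis using sum_le_suminf[OF s, of "{n}"] by simp
qed

text \<open>The weight is the supremum over \<open>B\<close> of the moduli of the
  \<open>n\<close>-th coefficients, times the factorial from the pairing. Each Fock norm controls
  every single coefficient, and having all these norms bounded makes the supremum decrease
  rapidly.\<close>

lemma F_bounded_imp_dominated:
  assumes B: "F_bounded B"
  obtains v where "v \<in> decreasing_weights"
    "\<And>f n. f \<in> B \<Longrightarrow> cmod (taylor_coeff f n) * fact n \<le> v n"
proof -
  have bound: "\<exists>C\<ge>0. \<forall>f\<in>B. \<forall>n. cmod (taylor_coeff f n) * fact n ^ Suc m \<le> C" for m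
  proof -
    \<comment> \<open>The norm of index \<open>2 * Suc m\<close> controls the coefficients times
      \<open>fact n ^ Suc m\<close>; one of these factorials is spent on the factor
      \<open>fact n\<close> in the weight.\<close>
    have "1 \<le> 2 * Suc m" by simp
    then obtain C where C: "\<And>f. f \<in> B \<Longrightarrow> fock_norm (2 * Suc m) f \<le> C"
      using B unfolding F_bounded_def by meson
    \<comment> \<open>The absolute value keeps the bound nonnegative even for empty
      \<open>B\<close>.\<close>
    have "cmod (taylor_coeff f n) * fact n ^ Suc m \<le> \<bar>C\<bar>" if f: "f \<in> B" for f n
    proof -
      have "f \<in> fock_space (2 * Suc m)"
        using f B \<open>1 \<le> 2 * Suc m\<close> unfolding F_bounded_def F_frechet_def by blast
      then have "(cmod (taylor_coeff f n))\<^sup>2 * (fact n :: real) powi int (2 * Suc m) \<le> (fock_norm (2 * Suc m) f)\<^sup>2"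
        unfolding fock_norm_def by (intro powi_le_weighted_norm) (simp add: fock_space_def)
      moreover have "(fact n :: real) powi int (2 * Suc m) = (fact n ^ Suc m)\<^sup>2"
        by (simp only: power_int_of_nat power_mult[symmetric] mult.commute)
      ultimately have "(cmod (taylor_coeff f n) * fact n ^ Suc m)\<^sup>2 \<le> (fock_norm (2 * Suc m) f)\<^sup>2"
        by (simp only: power_mult_distrib)
      moreover have "0 \<le> fock_norm (2 * Suc m) f"
        unfolding fock_norm_def weighted_norm_def
        using \<open>f \<in> fock_space _\<close> by (auto simp: fock_space_def weighted_l2_def intro!: suminf_nonneg)
      ultimately have "cmod (taylor_coeff f n) * fact n ^ Suc m \<le> fock_norm (2 * Suc m) f"
        by (rule power2_le_imp_le)
      then show ?thesis using C[OF f] by simp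
    qed
    then show ?thesis by (intro exI[of _ "\<bar>C\<bar>"]) auto
  qed
  \<comment> \<open>Inserting 0 gives a nonempty set with nonnegative supremum even when
    \<open>B\<close> is empty.\<close>
  define S where "S n = insert 0 ((\<lambda>f. cmod (taylor_coeff f n)) ` B)" for n
  define v where "v n = Sup (S n) * fact n" for n
  have bdd: "bdd_above (S n)" for n
  proof -
    obtain C where C: "0 \<le> C" "\<And>f. f \<in> B \<Longrightarrow> cmod (taylor_coeff f n) * fact n ^ Suc 0 \<le> C"
      using bound[of 0] by blast
    have "cmod (taylor_coeff f n) \<le> C / fact n" if "f \<in> B" for f
      using C(2)[OF that] by (simp add: field_simps)
    then show ?thesis using C(1) unfolding S_def bdd_above_def
      by (intro exI[of _ "C / fact n"]) auto
  qed
  have "0 \<le> v n" for n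
    unfolding v_def using cSup_upper[OF _ bdd, of 0 n] by (simp add: S_def)
  moreover have "\<exists>C. \<forall>n. v n * fact n ^ m \<le> C" for m
  proof -
    obtain C where C: "0 \<le> C" "\<And>f n. f \<in> B \<Longrightarrow> cmod (taylor_coeff f n) * fact n ^ Suc m \<le> C"
      using bound[of m] by blast
    have "v n * fact n ^ m \<le> C" for n
    proof -
      have "x \<le> C / fact n ^ Suc m" if "x \<in> S n" for x
        using that C(1) C(2)[of _ n] unfolding S_def by (auto simp: pos_le_divide_eq)
      then have "Sup (S n) \<le> C / fact n ^ Suc m"
        by (intro cSup_least) (auto simp: S_def)
      then show ?thesis unfolding v_def by (simp add: field_simps)
    qed
    then show ?thesis by blast
  qed
  ultimately have "v \<in> decreasing_weights" by (simp add: decreasing_weights_def)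
  moreover have "cmod (taylor_coeff f n) * fact n \<le> v n" if "f \<in> B" for f n
    unfolding v_def by (intro mult_right_mono cSup_upper bdd) (use that in \<open>auto simp: S_def\<close>)
  ultimately show thesis using that by blast
qed

text \<open>Squaring the pointwise bound produces \<open>fact n ^ (2 * m)\<close>, of which the norm
  consumes \<open>m\<close> powers; the surplus is at least \<open>fact n\<close>, so the
  exponential series is a majorant.\<close>

lemma weighted_l2_of_bound:
  assumes C: "\<And>n. cmod (g n) * fact n ^ m \<le> C" and m: "1 \<le> m"
  shows "g \<in> weighted_l2 (int m) \<and> weighted_norm (int m) g \<le> sqrt (C\<^sup>2 * exp 1)"
proof -
  have le: "(cmod (g n))\<^sup>2 * (fact n :: real) powi int m \<le> C\<^sup>2 * (1 / fact n)" for n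
  proof -
    have "(cmod (g n))\<^sup>2 * (fact n :: real) powi int m = (cmod (g n) * fact n ^ m)\<^sup>2 / fact n ^ m"
      by (simp add: power_mult_distrib power2_eq_square)
    also have "\<dots> \<le> C\<^sup>2 / fact n ^ m"
      by (intro divide_right_mono power_mono C) auto
    also have "\<dots> \<le> C\<^sup>2 / fact n"
      using m power_increasing[of 1 m "fact n :: real"]
      by (intro divide_left_mono) (auto simp: fact_ge_1)
    finally show ?thesis by simp
  qed
  have s: "(\<lambda>n. C\<^sup>2 * (1 / fact n)) sums (C\<^sup>2 * exp 1)"
    by (rule sums_mult[OF one_div_fact_sums])
  have g: "g \<in> weighted_l2 (int m)"
    unfolding weighted_l2_def mem_Collect_eq
    by (rule summable_le_nonneg[OF sums_summable[OF s] _ le]) simp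
  moreover have "weighted_norm (int m) g \<le> sqrt (C\<^sup>2 * exp 1)"
    unfolding weighted_norm_def sums_unique[OF s]
    by (intro real_sqrt_le_mono suminf_le le sums_summable[OF s]) (use g in \<open>simp add: weighted_l2_def\<close>)
  ultimately show ?thesis by blast
qed

text \<open>Coefficients of order \<open>1 / fact n\<close> are dominated by those of an exponential
  series, so the power series has infinite radius of convergence.\<close>

lemma taylor_coeff_surj:
  assumes C: "\<And>n. cmod (g n) * fact n \<le> C"
  obtains f where "f holomorphic_on UNIV" "taylor_coeff f = g"
proof -
  let ?f = "Abs_fps g"
  have "summable (\<lambda>n. g n * z ^ n)" for z
  proof (rule summable_comparison_test')
    show "summable (\<lambda>n. C * (inverse (fact n) * cmod z ^ n))"
      by (intro summable_mult summable_exp)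
    fix n
    have "cmod (g n) \<le> C * inverse (fact n)"
      using C[of n] by (simp add: field_simps)
    then show "norm (g n * z ^ n) \<le> C * (inverse (fact n) * cmod z ^ n)"
      using mult_right_mono[of "cmod (g n)" "C * inverse (fact n)" "cmod z ^ n"]
      by (simp add: norm_mult norm_power)
  qed
  then have r: "fps_conv_radius ?f = \<infinity>"
    unfolding fps_conv_radius_def by (intro conv_radius_inftyI'') auto
  have "eval_fps ?f holomorphic_on UNIV"
    by (intro holomorphic_on_eval_fps) (simp add: r eball_def)
  moreover have "taylor_coeff (eval_fps ?f) = g"
    by (rule ext, unfold taylor_coeff_def, subst fps_nth_conv_deriv[symmetric]) (simp_all add: r)
  ultimately show thesis using that by blast
qed

text \<open>These sets form a fundamental system of bounded sets: each is bounded, and every bounded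
  set lies in one of them. The factor \<open>fact n\<close> matches the one in the pairing.\<close>

definition dominated :: "(nat \<Rightarrow> real) \<Rightarrow> (complex \<Rightarrow> complex) set" where
  "dominated v = {f \<in> F_frechet. \<forall>n. cmod (taylor_coeff f n) * fact n \<le> v n}"

text \<open>The constant depends on \<open>v\<close> and \<open>m\<close> alone, so it serves all
  members of \<open>dominated v\<close> at once.\<close>

lemma decreasing_bound_mult:
  assumes "v \<in> decreasing_weights"
  obtains C where "\<And>g n. cmod (g n) * fact n \<le> v n \<Longrightarrow> cmod (g n) * fact n ^ m \<le> C"
proof -
  obtain C where C: "\<And>n. v n * fact n ^ m \<le> C"
    by (rule decreasing_weights_bound[OF assms]) blast
  have "cmod (g n) * fact n ^ m \<le> C" if "cmod (g n) * fact n \<le> v n" for g :: "nat \<Rightarrow> complex" and n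
  proof -
    have "cmod (g n) * 1 \<le> cmod (g n) * fact n"
      by (intro mult_left_mono) (auto simp: fact_ge_1)
    then have "cmod (g n) \<le> v n" using that by simp
    then have "cmod (g n) * fact n ^ m \<le> v n * fact n ^ m"
      by (rule mult_right_mono) simp
    then show ?thesis using C[of n] by (rule order_trans)
  qed
  then show thesis using that by blast
qed

lemma F_bounded_dominated:
  assumes v: "v \<in> decreasing_weights"
  shows "F_bounded (dominated v)"
  unfolding F_bounded_def
proof (intro conjI allI impI)
  show "dominated v \<subseteq> F_frechet" by (auto simp: dominated_def)
  fix m :: nat assume m: "1 \<le> m"
  obtain C where C: "\<And>g n. cmod (g n) * fact n \<le> v n \<Longrightarrow> cmod (g n) * fact n ^ m \<le> C"
    by (rule decreasing_bound_mult[OF v]) blast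
  have "fock_norm m f \<le> sqrt (C\<^sup>2 * exp 1)" if "f \<in> dominated v" for f
    unfolding fock_norm_def using that m
    by (intro weighted_l2_of_bound[THEN conjunct2] C) (auto simp: dominated_def)
  then show "\<exists>C. \<forall>f\<in>dominated v. fock_norm m f \<le> C" by blast
qed

text \<open>Supplies test functions with prescribed coefficients, from which an extremal function
  for the pairing is built.\<close>

lemma dominated_taylor_coeff_surj:
  assumes v: "v \<in> decreasing_weights" and g: "\<And>n. cmod (g n) * fact n \<le> v n"
  obtains f where "f \<in> dominated v" "taylor_coeff f = g"
proof -
  obtain C where C: "\<And>n. v n * fact n ^ 0 \<le> C"
    by (rule decreasing_weights_bound[OF v]) blast
  have "cmod (g n) * fact n \<le> C" for n
    using order_trans[OF g, of n C] C[of n] by simp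
  then obtain f where f: "f holomorphic_on UNIV" "taylor_coeff f = g"
    by (rule taylor_coeff_surj) blast
  have "g \<in> weighted_l2 (int m)" if m: "1 \<le> m" for m
  proof -
    obtain C where C: "\<And>g n. cmod (g n) * fact n \<le> v n \<Longrightarrow> cmod (g n) * fact n ^ m \<le> C"
      by (rule decreasing_bound_mult[OF v]) blast
    show ?thesis by (intro weighted_l2_of_bound[THEN conjunct1, OF C m] g)
  qed
  then have "f \<in> F_frechet" using f by (auto simp: F_frechet_def fock_space_def)
  then show thesis using that f g by (auto simp: dominated_def)
qed

text \<open>The easy half of the identification of the seminorm with the maximum of the modulus of
  the pairing over \<open>dominated v\<close>.\<close>

lemma fock_pairing_le:
  assumes v: "v \<in> decreasing_weights" and b: "b \<in> F_dual"
    and f: "\<And>n. cmod (taylor_coeff f n) * fact n \<le> v n"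
  shows "cmod (fock_pairing f b) \<le> weight_seminorm v b"
proof -
  have "norm (taylor_coeff f n * cnj (b n) * fact n) \<le> v n * cmod (b n)" for n
    using mult_right_mono[OF f[of n], of "cmod (b n)"] by (simp add: norm_mult mult_ac norm_fact)
  then show ?thesis
    unfolding fock_pairing_def weight_seminorm_def by (rule norm_suminf_le[OF _ summable_weight_seminorm[OF v b]])
qed

text \<open>The maximum of the pairing is attained where the Taylor coefficients of \<open>f\<close> have the phases
  of \<open>b\<close>.\<close>

lemma weight_seminorm_attained:
  assumes v: "v \<in> decreasing_weights" and b: "b \<in> F_dual"
  obtains f where "f \<in> dominated v" "cmod (fock_pairing f b) = weight_seminorm v b"
proof -
  \<comment> \<open>Dividing by \<open>fact n\<close> compensates the factorial in the pairing;
    \<open>sgn\<close> is the phase, with value 0 at 0.\<close>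
  define g where "g n = of_real (v n / fact n) * sgn (b n)" for n
  have "cmod (g n) * fact n \<le> v n" for n
    using decreasing_weights_nonneg[OF v, of n] by (auto simp: g_def norm_mult norm_sgn norm_divide norm_fact)
  then obtain f where f: "f \<in> dominated v" "taylor_coeff f = g"
    by (rule dominated_taylor_coeff_surj[OF v]) blast
  have "g n * cnj (b n) * fact n = of_real (v n * cmod (b n))" for n
  proof -
    have "sgn (b n) * cnj (b n) = of_real (cmod (b n))"
      by (cases "b n = 0")
        (simp_all add: sgn_div_norm scaleR_conv_of_real complex_norm_square[symmetric] mult.assoc
          power2_eq_square field_simps flip: of_real_mult)
    then have "g n * cnj (b n) * fact n = of_real (v n / fact n) * of_real (cmod (b n)) * fact n"
      unfolding g_def by (simp only: mult.assoc)
    then show ?thesis by simp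
  qed
  then have "fock_pairing f b = of_real (weight_seminorm v b)"
    unfolding fock_pairing_def f(2) weight_seminorm_def
    using suminf_of_real[OF summable_weight_seminorm[OF v b], where ?'a = complex] by simp
  then show thesis
    using that[OF f(1)] weight_seminorm_nonneg[OF v b] by simp
qed

text \<open>Forwards, a bounded set is replaced by a weight that dominates it. Backwards,
  \<open>dominated v\<close> is itself a bounded set, and the seminorm is attained on it.\<close>

lemma strong_dual_open_iff:
  "strong_dual_open U \<longleftrightarrow> U \<subseteq> F_dual \<and>
     (\<forall>b\<in>U. \<exists>v\<in>decreasing_weights. \<exists>\<epsilon>>0. \<forall>c\<in>F_dual. weight_seminorm v (\<lambda>n. c n - b n) < \<epsilon> \<longrightarrow> c \<in> U)"
  (is "_ \<longleftrightarrow> ?R")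
proof
  assume U: "strong_dual_open U"
  have "\<exists>v\<in>decreasing_weights. \<exists>\<epsilon>>0. \<forall>c\<in>F_dual. weight_seminorm v (\<lambda>n. c n - b n) < \<epsilon> \<longrightarrow> c \<in> U"
    if b: "b \<in> U" for b
  proof -
    obtain B \<epsilon> where B: "F_bounded B" "0 < \<epsilon>" "strong_nbhd b B \<epsilon> \<subseteq> U"
      using U b unfolding strong_dual_open_def by blast
    have bF: "b \<in> F_dual" using U b by (auto simp: strong_dual_open_def)
    obtain v where v: "v \<in> decreasing_weights" "\<And>f n. f \<in> B \<Longrightarrow> cmod (taylor_coeff f n) * fact n \<le> v n"
      by (rule F_bounded_imp_dominated[OF B(1)]) blast
    have "c \<in> U" if c: "c \<in> F_dual" "weight_seminorm v (\<lambda>n. c n - b n) < \<epsilon>" for c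
    proof -
      have "cmod (fock_pairing f (\<lambda>n. c n - b n)) \<le> \<epsilon>" if "f \<in> B" for f
        using fock_pairing_le[OF v(1) F_dual_diff[OF c(1) bF] v(2)[OF that]] c(2) by simp
      then show ?thesis using B(3) c(1) by (auto simp: strong_nbhd_def)
    qed
    then show ?thesis using v(1) B(2) by blast
  qed
  then show ?R using U by (auto simp: strong_dual_open_def)
next
  assume R: ?R
  show "strong_dual_open U"
    unfolding strong_dual_open_def
  proof (intro conjI ballI)
    show "U \<subseteq> F_dual" using R by blast
    fix b assume b: "b \<in> U"
    then have bF: "b \<in> F_dual" using R by blast
    obtain v \<epsilon> where v: "v \<in> decreasing_weights" "0 < \<epsilon>"
      "\<And>c. c \<in> F_dual \<Longrightarrow> weight_seminorm v (\<lambda>n. c n - b n) < \<epsilon> \<Longrightarrow> c \<in> U"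
      using R b by meson
    \<comment> \<open>Halving passes from the non-strict inequality in \<open>strong_nbhd\<close> to
      the strict one for the seminorm.\<close>
    have "strong_nbhd b (dominated v) (\<epsilon> / 2) \<subseteq> U"
    proof
      fix c assume c: "c \<in> strong_nbhd b (dominated v) (\<epsilon> / 2)"
      then have cF: "c \<in> F_dual" by (simp add: strong_nbhd_def)
      obtain f where "f \<in> dominated v"
        "cmod (fock_pairing f (\<lambda>n. c n - b n)) = weight_seminorm v (\<lambda>n. c n - b n)"
        by (rule weight_seminorm_attained[OF v(1) F_dual_diff[OF cF bF]]) blast
      then have "weight_seminorm v (\<lambda>n. c n - b n) \<le> \<epsilon> / 2"
        using c by (auto simp: strong_nbhd_def)
      then show "c \<in> U" using v(2) by (intro v(3) cF) simp
    qed
    then show "\<exists>B \<epsilon>. F_bounded B \<and> 0 < \<epsilon> \<and> strong_nbhd b B \<epsilon> \<subseteq> U"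
      using F_bounded_dominated[OF v(1)] v(2) half_gt_zero by blast
  qed
qed

section \<open>Separation and continuity in the strong topology\<close>

definition seminorm_ball :: "(nat \<Rightarrow> real) \<Rightarrow> (nat \<Rightarrow> complex) \<Rightarrow> real \<Rightarrow> (nat \<Rightarrow> complex) set" where
  "seminorm_ball v b \<epsilon> = {c \<in> F_dual. weight_seminorm v (\<lambda>n. c n - b n) < \<epsilon>}"

lemma openin_seminorm_ball:
  assumes v: "v \<in> decreasing_weights" and b: "b \<in> F_dual"
  shows "openin strong_dual_topology (seminorm_ball v b \<epsilon>)"
  unfolding openin_strong_dual_topology strong_dual_open_iff
proof (intro conjI ballI)
  show "seminorm_ball v b \<epsilon> \<subseteq> F_dual" by (auto simp: seminorm_ball_def)
  fix c assume c: "c \<in> seminorm_ball v b \<epsilon>"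
  then have cF: "c \<in> F_dual" by (simp add: seminorm_ball_def)
  let ?\<delta> = "\<epsilon> - weight_seminorm v (\<lambda>n. c n - b n)"
  have "d \<in> seminorm_ball v b \<epsilon>" if d: "d \<in> F_dual" "weight_seminorm v (\<lambda>n. d n - c n) < ?\<delta>" for d
    using weight_seminorm_add_le[OF v F_dual_diff[OF d(1) cF] F_dual_diff[OF cF b]] d
    by (simp add: seminorm_ball_def)
  moreover have "0 < ?\<delta>" using c by (simp add: seminorm_ball_def)
  ultimately show "\<exists>u\<in>decreasing_weights. \<exists>\<delta>>0. \<forall>d\<in>F_dual.
      weight_seminorm u (\<lambda>n. d n - c n) < \<delta> \<longrightarrow> d \<in> seminorm_ball v b \<epsilon>"
    using v by blast
qed

lemma center_in_seminorm_ball: "b \<in> F_dual \<Longrightarrow> 0 < \<epsilon> \<Longrightarrow> b \<in> seminorm_ball v b \<epsilon>"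
  by (simp add: seminorm_ball_def weight_seminorm_def)

text \<open>Reduces continuity to estimating one seminorm at a time near each point: the sets
  \<open>W\<close> cover the preimage of an open set and lie inside it.\<close>

lemma continuous_map_strong_dualI:
  assumes F: "\<And>x. x \<in> topspace X \<Longrightarrow> f x \<in> F_dual"
    and nbhd: "\<And>x v \<epsilon>. x \<in> topspace X \<Longrightarrow> v \<in> decreasing_weights \<Longrightarrow> 0 < \<epsilon> \<Longrightarrow>
      \<exists>W. openin X W \<and> x \<in> W \<and> (\<forall>y\<in>W. weight_seminorm v (\<lambda>n. f y n - f x n) < \<epsilon>)"
  shows "continuous_map X strong_dual_topology f"
  unfolding continuous_map_def
proof (intro conjI allI impI)
  show "f \<in> topspace X \<rightarrow> topspace strong_dual_topology"
    using F by (auto simp: topspace_strong_dual_topology)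
  fix U assume U: "openin strong_dual_topology U"
  show "openin X {x \<in> topspace X. f x \<in> U}"
  proof (subst openin_subopen, intro ballI)
    fix x assume x: "x \<in> {x \<in> topspace X. f x \<in> U}"
    then obtain v \<epsilon> where v: "v \<in> decreasing_weights" "0 < \<epsilon>"
      "\<And>c. c \<in> F_dual \<Longrightarrow> weight_seminorm v (\<lambda>n. c n - f x n) < \<epsilon> \<Longrightarrow> c \<in> U"
      using U unfolding openin_strong_dual_topology strong_dual_open_iff mem_Collect_eq by meson
    obtain W where W: "openin X W" "x \<in> W" "\<And>y. y \<in> W \<Longrightarrow> weight_seminorm v (\<lambda>n. f y n - f x n) < \<epsilon>"
      using nbhd[of x v \<epsilon>] x v by blast
    have "W \<subseteq> {x \<in> topspace X. f x \<in> U}"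
      using W openin_subset[OF W(1)] v(3) F by blast
    then show "\<exists>T. openin X T \<and> x \<in> T \<and> T \<subseteq> {x \<in> topspace X. f x \<in> U}"
      using W by blast
  qed
qed

text \<open>Distinct sequences differ at some index \<open>n\<close>, and the weight supported there
  has the seminorm \<open>cmod (c n)\<close>.\<close>

lemma Hausdorff_strong_dual_topology: "Hausdorff_space strong_dual_topology"
  unfolding Hausdorff_space_def topspace_strong_dual_topology
proof (intro allI impI)
  fix a b assume "a \<in> F_dual \<and> b \<in> F_dual \<and> a \<noteq> b"
  then have ab: "a \<in> F_dual" "b \<in> F_dual" and "a \<noteq> b" by auto
  then obtain n where n: "a n \<noteq> b n" by auto
  define v :: "nat \<Rightarrow> real" where "v k = (if k = n then 1 else 0)" for k
  have v: "v \<in> decreasing_weights"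
    unfolding decreasing_weights_def v_def by (auto intro!: exI[of _ "fact n ^ _"])
  have semi: "weight_seminorm v c = cmod (c n)" for c
    using suminf_finite[of "{n}" "\<lambda>k. v k * cmod (c k)"] by (simp add: weight_seminorm_def v_def)
  define \<epsilon> where "\<epsilon> = cmod (a n - b n) / 2"
  have "disjnt (seminorm_ball v a \<epsilon>) (seminorm_ball v b \<epsilon>)"
    unfolding disjnt_iff seminorm_ball_def semi \<epsilon>_def
    using norm_triangle_half_r[of _ "a n" "cmod (a n - b n)" "b n"] by (auto simp: norm_minus_commute)
  moreover have "0 < \<epsilon>" using n by (simp add: \<epsilon>_def)
  ultimately show "\<exists>U V. openin strong_dual_topology U \<and> openin strong_dual_topology V \<and>
      a \<in> U \<and> b \<in> V \<and> disjnt U V"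
    by (intro exI[of _ "seminorm_ball v a \<epsilon>"] exI[of _ "seminorm_ball v b \<epsilon>"] conjI
        openin_seminorm_ball center_in_seminorm_ball v ab)
qed

lemma continuous_map_strong_dual_add:
  "continuous_map (prod_topology strong_dual_topology strong_dual_topology) strong_dual_topology
     (\<lambda>(x, y) n. x n + y n)"
proof (rule continuous_map_strong_dualI; clarsimp simp: topspace_strong_dual_topology)
  fix a b :: "nat \<Rightarrow> complex" and v and \<epsilon> :: real
  assume ab: "a \<in> F_dual" "b \<in> F_dual" and v: "v \<in> decreasing_weights" and \<epsilon>: "0 < \<epsilon>"
  let ?W = "seminorm_ball v a (\<epsilon> / 2) \<times> seminorm_ball v b (\<epsilon> / 2)"
  have "weight_seminorm v (\<lambda>n. x n + y n - (a n + b n)) < \<epsilon>" if "(x, y) \<in> ?W" for x y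
  proof -
    have xy: "x \<in> F_dual" "y \<in> F_dual"
      "weight_seminorm v (\<lambda>n. x n - a n) < \<epsilon> / 2" "weight_seminorm v (\<lambda>n. y n - b n) < \<epsilon> / 2"
      using that by (auto simp: seminorm_ball_def)
    have "weight_seminorm v (\<lambda>n. x n + y n - (a n + b n))
        = weight_seminorm v (\<lambda>n. (x n - a n) + (y n - b n))"
      by (simp add: algebra_simps)
    then show ?thesis
      using weight_seminorm_add_le[OF v F_dual_diff[OF xy(1) ab(1)] F_dual_diff[OF xy(2) ab(2)]] xy(3,4)
      by linarith
  qed
  then show "\<exists>W. openin (prod_topology strong_dual_topology strong_dual_topology) W \<and> (a, b) \<in> W \<and>
      (\<forall>y\<in>W. weight_seminorm v (\<lambda>n. (case y of (x, y) \<Rightarrow> \<lambda>n. x n + y n) n - (a n + b n)) < \<epsilon>)"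
    using \<epsilon>
    by (intro exI[of _ ?W])
      (auto simp: openin_prod_Times_iff openin_seminorm_ball v ab center_in_seminorm_ball)
qed (rule F_dual_add)

lemma continuous_map_strong_dual_conv:
  "continuous_map (prod_topology strong_dual_topology strong_dual_topology) strong_dual_topology
     (\<lambda>(x, y). x \<star> y)"
proof (rule continuous_map_strong_dualI; clarsimp simp: topspace_strong_dual_topology)
  fix a b :: "nat \<Rightarrow> complex" and v and \<epsilon> :: real
  assume ab: "a \<in> F_dual" "b \<in> F_dual" and v: "v \<in> decreasing_weights" and \<epsilon>: "0 < \<epsilon>"
  obtain u where u: "u \<in> decreasing_weights"
    and le: "\<And>a b. a \<in> F_dual \<Longrightarrow> b \<in> F_dual \<Longrightarrow>
       weight_seminorm v (a \<star> b) \<le> weight_seminorm u a * weight_seminorm u b"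
    by (rule weight_seminorm_conv_le[OF v]) blast
  \<comment> \<open>The three error terms will add up to less than \<open>\<delta> * K\<close>; the
    bound \<open>\<delta> <= 1\<close> makes the quadratic term linear in \<open>\<delta>\<close>,
    which accounts for the summand 1.\<close>
  define K where "K = 1 + weight_seminorm u a + weight_seminorm u b"
  define \<delta> where "\<delta> = min 1 (\<epsilon> / K)"
  have pos: "0 \<le> weight_seminorm u a" "0 \<le> weight_seminorm u b"
    by (intro weight_seminorm_nonneg u ab)+
  then have K: "0 < K" by (simp add: K_def)
  then have \<delta>: "0 < \<delta>" "\<delta> \<le> 1" "\<delta> * K \<le> \<epsilon>"
    using \<epsilon> by (auto simp: \<delta>_def min_def field_simps)
  let ?W = "seminorm_ball u a \<delta> \<times> seminorm_ball u b \<delta>"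
  have "weight_seminorm v (\<lambda>n. (x \<star> y) n - (a \<star> b) n) < \<epsilon>" if "(x, y) \<in> ?W" for x y
  proof -
    define s t where "s n = x n - a n" and "t n = y n - b n" for n
    have "x \<in> F_dual" "y \<in> F_dual" using that by (auto simp: seminorm_ball_def)
    then have st: "s \<in> F_dual" "t \<in> F_dual"
      unfolding s_def t_def using ab by (auto intro: F_dual_diff)
    have lt: "weight_seminorm u s < \<delta>" "weight_seminorm u t < \<delta>"
      using that by (auto simp: seminorm_ball_def s_def[abs_def] t_def[abs_def])
    have st0: "0 \<le> weight_seminorm u s" "0 \<le> weight_seminorm u t"
      by (intro weight_seminorm_nonneg u st)+
    \<comment> \<open>Bilinear expansion of the product at \<open>x = a + s\<close> and
      \<open>y = b + t\<close>.\<close>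
    have "(x \<star> y) n - (a \<star> b) n = (s \<star> t) n + ((a \<star> t) n + (s \<star> b) n)" for n
      by (simp add: convolution_def s_def t_def algebra_simps flip: sum.distrib sum_subtractf)
    then have "weight_seminorm v (\<lambda>n. (x \<star> y) n - (a \<star> b) n)
        \<le> weight_seminorm v (s \<star> t) + (weight_seminorm v (a \<star> t) + weight_seminorm v (s \<star> b))"
      using weight_seminorm_add_le[OF v F_dual_conv[OF st] F_dual_add[OF F_dual_conv[OF ab(1) st(2)] F_dual_conv[OF st(1) ab(2)]]]
        weight_seminorm_add_le[OF v F_dual_conv[OF ab(1) st(2)] F_dual_conv[OF st(1) ab(2)]] by simp
    also have "\<dots> \<le> weight_seminorm u s * weight_seminorm u t
        + (weight_seminorm u a * weight_seminorm u t + weight_seminorm u s * weight_seminorm u b)"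
      by (intro add_mono le ab st)
    also have "\<dots> \<le> weight_seminorm u s * 1 + (weight_seminorm u a * \<delta> + \<delta> * weight_seminorm u b)"
      using lt \<delta> pos st0 by (intro add_mono mult_mono) auto
    also have "\<dots> < \<delta> + (weight_seminorm u a * \<delta> + \<delta> * weight_seminorm u b)"
      using lt by simp
    also have "\<dots> = \<delta> * K" by (simp add: K_def algebra_simps)
    finally show ?thesis using \<delta> by simp
  qed
  then show "\<exists>W. openin (prod_topology strong_dual_topology strong_dual_topology) W \<and> (a, b) \<in> W \<and>
      (\<forall>y\<in>W. weight_seminorm v (\<lambda>n. (case y of (x, y) \<Rightarrow> x \<star> y) n - (a \<star> b) n) < \<epsilon>)"
    using \<delta>
    by (intro exI[of _ ?W])
      (auto simp: openin_prod_Times_iff openin_seminorm_ball u ab center_in_seminorm_ball)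
qed (rule F_dual_conv)

lemma continuous_map_delta:
  "continuous_map euclidean strong_dual_topology (\<lambda>c n. if n = 0 then c else 0)"
proof (rule continuous_map_strong_dualI; clarsimp simp: F_dual_delta)
  fix c :: complex and v and \<epsilon> :: real
  assume v: "v \<in> decreasing_weights" and \<epsilon>: "0 < \<epsilon>"
  have semi: "weight_seminorm v (\<lambda>n. (if n = 0 then d else 0) - (if n = 0 then c else 0)) = v 0 * cmod (d - c)"
    for d
    unfolding weight_seminorm_def by (subst suminf_finite[of "{0}"]) auto
  \<comment> \<open>Adding 1 avoids division by zero, since \<open>v 0\<close> may vanish.\<close>
  let ?r = "\<epsilon> / (1 + v 0)"
  have v0: "0 \<le> v 0" by (rule decreasing_weights_nonneg[OF v])
  have "v 0 * cmod (d - c) < \<epsilon>" if "d \<in> ball c ?r" for d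
  proof -
    have "v 0 * cmod (d - c) \<le> (1 + v 0) * cmod (d - c)" by (simp add: distrib_right)
    also have "\<dots> < \<epsilon>"
      using that v0 by (simp add: dist_norm norm_minus_commute pos_less_divide_eq mult.commute)
    finally show ?thesis .
  qed
  then show "\<exists>W. open W \<and> c \<in> W \<and>
      (\<forall>d\<in>W. weight_seminorm v (\<lambda>n. (if n = 0 then d else 0) - (if n = 0 then c else 0)) < \<epsilon>)"
    unfolding semi using \<epsilon> v0 by (intro exI[of _ "ball c ?r"]) auto
qed

text \<open>Scaling is the continuous embedding of scalars followed by the jointly continuous
  convolution.\<close>

lemma continuous_map_strong_dual_scale:
  "continuous_map (prod_topology euclidean strong_dual_topology) strong_dual_topology
     (\<lambda>(c, x) n. c * x n)"
proof -
  have "continuous_map (prod_topology euclidean strong_dual_topology)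
      (prod_topology strong_dual_topology strong_dual_topology)
      (\<lambda>p. ((\<lambda>n. if n = 0 then fst p else 0), snd p))"
    by (intro continuous_map_pairedI continuous_map_snd
        continuous_map_compose[OF continuous_map_fst continuous_map_delta, unfolded o_def])
  from continuous_map_compose[OF this continuous_map_strong_dual_conv]
  show ?thesis by (simp add: o_def conv_delta case_prod_unfold)
qed

section \<open>The algebra structure\<close>

lemma cring_complex_ring: "cring complex_ring"
proof (rule cringI)
  show "abelian_group complex_ring"
    by (rule abelian_groupI) (auto simp: complex_ring_def intro: exI[of _ "- _"])
  show "comm_monoid complex_ring"
    by (rule comm_monoidI) (auto simp: complex_ring_def)
qed (auto simp: complex_ring_def distrib_right)

lemma abelian_group_F_dual_algebra: "abelian_group F_dual_algebra"
proof (rule abelian_groupI)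
  fix x assume "x \<in> carrier F_dual_algebra"
  then show "\<exists>y\<in>carrier F_dual_algebra. y \<oplus>\<^bsub>F_dual_algebra\<^esub> x = \<zero>\<^bsub>F_dual_algebra\<^esub>"
    using F_dual_scale[of x "- 1"]
    by (intro bexI[of _ "\<lambda>n. - 1 * x n"]) (auto simp: F_dual_algebra_def)
qed (auto simp: F_dual_algebra_def F_dual_add F_dual_zero algebra_simps)

text \<open>The laws involving the right factor follow from those for the left factor by
  commutativity.\<close>

lemma ring_F_dual_algebra: "Ring.ring F_dual_algebra"
proof (rule ringI[OF abelian_group_F_dual_algebra])
  show "Group.monoid F_dual_algebra"
    by (rule monoidI)
      (auto simp: F_dual_algebra_def F_dual_conv F_dual_delta conv_assoc conv_delta conv_commute[of _ "\<lambda>n. if n = 0 then 1 else 0"])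
qed (auto simp: F_dual_algebra_def conv_add_left conv_commute[of _ "\<lambda>n. _ n + _ n"] conv_commute)

lemma module_F_dual_algebra: "Module.module complex_ring F_dual_algebra"
  by (rule moduleI[OF cring_complex_ring abelian_group_F_dual_algebra])
    (auto simp: F_dual_algebra_def complex_ring_def F_dual_scale algebra_simps)

lemma conv_scale_left: "(\<lambda>n. c * a n) \<star> b = (\<lambda>n. c * (a \<star> b) n)"
  by (simp flip: conv_delta add: conv_assoc)

lemma conv_scale_right: "a \<star> (\<lambda>n. c * b n) = (\<lambda>n. c * (a \<star> b) n)"
  using conv_scale_left[of c b a] by (simp add: conv_commute)

lemma topological_algebra_F_dual: "topological_algebra strong_dual_topology F_dual_algebra"
  unfolding topological_algebra_def
  using module_F_dual_algebra ring_F_dual_algebra Hausdorff_strong_dual_topology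
    continuous_map_strong_dual_add continuous_map_strong_dual_scale continuous_map_strong_dual_conv
  by (simp add: F_dual_algebra_def topspace_strong_dual_topology conv_scale_left conv_scale_right)

section \<open>The norm estimate\<close>

text \<open>The finite inequality bounds all partial sums by the same constant; nonnegative terms
  then give both convergence and the bound on the sum.\<close>

lemma suminf_Cauchy_Schwarz:
  fixes f g :: "nat \<Rightarrow> real"
  assumes pos: "\<And>n. 0 \<le> f n" "\<And>n. 0 \<le> g n"
    and sum: "summable (\<lambda>n. (f n)\<^sup>2)" "summable (\<lambda>n. (g n)\<^sup>2)"
  shows "summable (\<lambda>n. f n * g n)"
    and "(\<Sum>n. f n * g n) \<le> sqrt (\<Sum>n. (f n)\<^sup>2) * sqrt (\<Sum>n. (g n)\<^sup>2)"
proof -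
  let ?K = "sqrt (\<Sum>n. (f n)\<^sup>2) * sqrt (\<Sum>n. (g n)\<^sup>2)"
  have le: "(\<Sum>k<n. f k * g k) \<le> ?K" for n
  proof -
    have "(\<Sum>k<n. f k * g k)\<^sup>2 \<le> (\<Sum>k<n. (f k)\<^sup>2) * (\<Sum>k<n. (g k)\<^sup>2)"
      by (rule Cauchy_Schwarz_ineq_sum)
    also have "\<dots> \<le> (\<Sum>n. (f n)\<^sup>2) * (\<Sum>n. (g n)\<^sup>2)"
      using sum by (intro mult_mono sum_le_suminf sum_nonneg suminf_nonneg) auto
    finally show ?thesis by (simp add: real_le_rsqrt flip: real_sqrt_mult)
  qed
  show s: "summable (\<lambda>n. f n * g n)"
    using pos by (intro bounded_imp_summable[of _ ?K] le[of "Suc _", unfolded lessThan_Suc_atMost]) simp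
  show "(\<Sum>n. f n * g n) \<le> ?K"
    by (rule suminf_le_const[OF s le])
qed

text \<open>Cauchy--Schwarz with respect to the weights \<open>c (n - k)\<close> bounds the square of the convolution
  by the Cauchy product of \<open>f\<^sup>2\<close> and \<open>c\<close>.\<close>

lemma Young_l2_l1:
  fixes f c :: "nat \<Rightarrow> real"
  assumes c: "\<And>n. 0 \<le> c n"
    and sum: "summable (\<lambda>n. (f n)\<^sup>2)" "summable c"
  shows "summable (\<lambda>n. (\<Sum>k\<le>n. f k * c (n - k))\<^sup>2)"
    and "(\<Sum>n. (\<Sum>k\<le>n. f k * c (n - k))\<^sup>2) \<le> (\<Sum>n. (f n)\<^sup>2) * (suminf c)\<^sup>2"
proof -
  have abs: "summable (\<lambda>n. norm ((f n)\<^sup>2))" "summable (\<lambda>n. norm (c n))"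
    using sum c by simp_all
  let ?h = "\<lambda>n. (\<Sum>k\<le>n. (f k)\<^sup>2 * c (n - k)) * suminf c"
  have le: "(\<Sum>k\<le>n. f k * c (n - k))\<^sup>2 \<le> ?h n" for n
  proof -
    have "(\<Sum>k\<le>n. f k * c (n - k))\<^sup>2 = (\<Sum>k\<le>n. (f k * sqrt (c (n - k))) * sqrt (c (n - k)))\<^sup>2"
      using c by (simp add: mult.assoc)
    also have "\<dots> \<le> (\<Sum>k\<le>n. (f k * sqrt (c (n - k)))\<^sup>2) * (\<Sum>k\<le>n. (sqrt (c (n - k)))\<^sup>2)"
      by (rule Cauchy_Schwarz_ineq_sum)
    also have "\<dots> = (\<Sum>k\<le>n. (f k)\<^sup>2 * c (n - k)) * (\<Sum>k\<le>n. c (n - k))"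
      using c by (simp add: power_mult_distrib)
    also have "(\<Sum>k\<le>n. c (n - k)) = (\<Sum>k\<le>n. c k)"
      by (rule sum.reindex_bij_witness[of _ "\<lambda>k. n - k" "\<lambda>k. n - k"]) auto
    also have "(\<Sum>k\<le>n. (f k)\<^sup>2 * c (n - k)) * (\<Sum>k\<le>n. c k) \<le> ?h n"
      using c by (intro mult_left_mono sum_le_suminf sum sum_nonneg) auto
    finally show ?thesis .
  qed
  \<comment> \<open>One factor \<open>suminf c\<close> comes from the Cauchy product, the other from
    the Cauchy--Schwarz step.\<close>
  have h: "?h sums ((\<Sum>n. (f n)\<^sup>2) * suminf c * suminf c)"
    by (intro sums_mult2 Cauchy_product_sums abs)
  show s: "summable (\<lambda>n. (\<Sum>k\<le>n. f k * c (n - k))\<^sup>2)"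
    by (rule summable_le_nonneg[OF sums_summable[OF h] _ le]) simp
  show "(\<Sum>n. (\<Sum>k\<le>n. f k * c (n - k))\<^sup>2) \<le> (\<Sum>n. (f n)\<^sup>2) * (suminf c)\<^sup>2"
    using suminf_le[OF le s sums_summable[OF h]] sums_unique[OF h]
    by (simp add: power2_eq_square mult.assoc)
qed

lemma weighted_norm_conv_le:
  fixes p q :: nat
  assumes q: "p + 1 \<le> q" "1 \<le> p"
    and a: "a \<in> weighted_l2 (2 - int q)" and b: "b \<in> weighted_l2 (2 - int p)"
  shows "a \<star> b \<in> weighted_l2 (2 - int q)"
    and "weighted_norm (2 - int q) (a \<star> b)
      \<le> A_const (q - p) * weighted_norm (2 - int q) a * weighted_norm (2 - int p) b"
proof -
  define w where "w k n = sqrt ((fact n :: real) powi k)" for k n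
  have w: "(w k n)\<^sup>2 = fact n powi k" "0 \<le> w k n" for k n by (simp_all add: w_def)
  define f where "f n = cmod (a n) * w (2 - int q) n" for n
  define g where "g n = cmod (b n) * w (2 - int p) n" for n
  \<comment> \<open>The exponents \<open>2 - p\<close> and \<open>p - q\<close> add up to
    \<open>2 - q\<close>, so \<open>c\<close> is \<open>b\<close> with the weight of the larger
    space. Splitting it into two square-summable factors yields the norm of \<open>b\<close> and the
    constant \<open>A_const (q - p)\<close>.\<close>
  define c where "c n = g n * w (int p - int q) n" for n
  have sq: "(f n)\<^sup>2 = (cmod (a n))\<^sup>2 * fact n powi (2 - int q)"
    "(g n)\<^sup>2 = (cmod (b n))\<^sup>2 * fact n powi (2 - int p)" for n
    by (simp_all add: f_def g_def power_mult_distrib w)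
  have A: "(fact n :: real) powi (int p - int q) = (1 / fact n) ^ (q - p)" for n
    using q by (simp add: power_int_def nat_diff_distrib' power_one_over inverse_eq_divide)
  have f: "summable (\<lambda>n. (f n)\<^sup>2)" and g: "summable (\<lambda>n. (g n)\<^sup>2)"
    using a b unfolding sq by (simp_all add: weighted_l2_def)
  have r: "summable (\<lambda>n. (w (int p - int q) n)\<^sup>2)"
    unfolding w A using q by (intro summable_A_const) simp
  have c0: "0 \<le> c n" for n by (simp add: c_def g_def w)
  have c: "summable c" "suminf c \<le> weighted_norm (2 - int p) b * A_const (q - p)"
    using suminf_Cauchy_Schwarz[of g "w (int p - int q)"] g r
    by (simp_all add: c_def[abs_def] weighted_norm_def A_const_def w A sq) (auto simp: g_def w)
  have c': "c n = cmod (b n) * w (2 - int q) n" for n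
  proof -
    have "(2 - int p) + (int p - int q) = 2 - int q" by simp
    then have "(fact n :: real) powi (2 - int q) = fact n powi (2 - int p) * fact n powi (int p - int q)"
      by (metis fact_nonzero power_int_add)
    then have "w (2 - int q) n = w (2 - int p) n * w (int p - int q) n"
      by (simp only: w_def real_sqrt_mult)
    then show ?thesis by (simp add: c_def g_def)
  qed
  have w_submult: "w (2 - int q) n \<le> w (2 - int q) k * w (2 - int q) (n - k)" if "k \<le> n" for k n
  proof -
    \<comment> \<open>Here \<open>q >= 2\<close>, so the natural subtraction is exact and the
      exponent is nonpositive; inversion then turns the factorial inequality into
      submultiplicativity.\<close>
    have "2 - int q = - int (q - 2)" using q by simp
    then have e: "(x :: real) powi (2 - int q) = inverse (x ^ (q - 2))" for x
      by (simp only: power_int_minus power_int_of_nat)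
    have "(fact n :: real) powi (2 - int q) \<le> fact k powi (2 - int q) * fact (n - k) powi (2 - int q)"
      unfolding e inverse_mult_distrib[symmetric] power_mult_distrib[symmetric]
      using that by (intro le_imp_inverse_le power_mono fact_mult_fact_diff_le) auto
    then show ?thesis unfolding w_def real_sqrt_mult[symmetric] by simp
  qed
  have le: "(cmod ((a \<star> b) n))\<^sup>2 * fact n powi (2 - int q) \<le> (\<Sum>k\<le>n. f k * c (n - k))\<^sup>2" for n
  proof -
    have "cmod ((a \<star> b) n) * w (2 - int q) n \<le> (\<Sum>k\<le>n. cmod (a k) * cmod (b (n - k))) * w (2 - int q) n"
      unfolding convolution_def by (intro mult_right_mono sum_norm_le w) (simp add: norm_mult)
    also have "\<dots> \<le> (\<Sum>k\<le>n. cmod (a k) * cmod (b (n - k)) * (w (2 - int q) k * w (2 - int q) (n - k)))"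
      unfolding sum_distrib_right by (intro sum_mono mult_left_mono w_submult) auto
    also have "\<dots> = (\<Sum>k\<le>n. f k * c (n - k))"
      by (simp add: f_def c' mult_ac)
    finally have "(cmod ((a \<star> b) n) * w (2 - int q) n)\<^sup>2 \<le> (\<Sum>k\<le>n. f k * c (n - k))\<^sup>2"
      by (rule power_mono) (simp add: w)
    then show ?thesis by (simp add: power_mult_distrib w)
  qed
  note Y = Young_l2_l1[of c f, OF c0 f c(1)]
  show ab: "a \<star> b \<in> weighted_l2 (2 - int q)"
    unfolding weighted_l2_def mem_Collect_eq
    by (rule summable_le_nonneg[OF Y(1) _ le]) simp
  have "weighted_norm (2 - int q) (a \<star> b) \<le> sqrt ((\<Sum>n. (f n)\<^sup>2) * (suminf c)\<^sup>2)"
    unfolding weighted_norm_def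
    using ab by (intro real_sqrt_le_mono order_trans[OF suminf_le[OF le _ Y(1)] Y(2)]) (simp add: weighted_l2_def)
  also have "\<dots> = weighted_norm (2 - int q) a * suminf c"
    using suminf_nonneg[OF c(1) c0] by (simp add: real_sqrt_mult weighted_norm_def sq)
  also have "\<dots> \<le> weighted_norm (2 - int q) a * (weighted_norm (2 - int p) b * A_const (q - p))"
    using suminf_nonneg[OF f] by (intro mult_left_mono c) (simp add: weighted_norm_def sq)
  finally show "weighted_norm (2 - int q) (a \<star> b)
      \<le> A_const (q - p) * weighted_norm (2 - int q) a * weighted_norm (2 - int p) b"
    by (simp add: mult_ac)
qed

theorem proposition6p2:
  shows "F_dual = {b. \<exists>m::nat. m \<ge> 1 \<and> summable (\<lambda>n. (cmod (b n))\<^sup>2 / (fact n :: real) powi (int m - 2))}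
    \<and> topological_algebra strong_dual_topology F_dual_algebra
    \<and> (\<forall>p q :: nat. \<forall>a b. p \<ge> 1 \<longrightarrow> q \<ge> p + 1 \<longrightarrow>
          a \<in> weighted_l2 (2 - int q) \<longrightarrow> b \<in> weighted_l2 (2 - int p) \<longrightarrow>
          a \<star> b \<in> weighted_l2 (2 - int q) \<and>
          weighted_norm (2 - int q) (a \<star> b)
            \<le> A_const (q - p) * weighted_norm (2 - int q) a * weighted_norm (2 - int p) b)"
proof -
  \<comment> \<open>Reconciles the quotient form of the norm with the weight of exponent
    \<open>2 - m\<close>.\<close>
  have "x / (fact n :: real) powi (int m - 2) = x * fact n powi (2 - int m)" for x n m
    using power_int_minus[of "fact n :: real" "int m - 2"] by (simp add: divide_inverse)
  then have "F_dual = {b. \<exists>m::nat. m \<ge> 1 \<and> summable (\<lambda>n. (cmod (b n))\<^sup>2 / (fact n :: real) powi (int m - 2))}"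
    by (auto simp: F_dual_def weighted_l2_def)
  then show ?thesis using topological_algebra_F_dual weighted_norm_conv_le by blast
qed

end
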